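(* Let $(\mathcal{M}, f, \star)$ and $(\mathcal{N}, g, \ltimes)$ be free $(1,2)$-magmas with generating sets $X_{\mathcal{M}}$ and $X_{\mathcal{N}}$ respectively, with $|X_{\mathcal{M}}| = |X_{\mathcal{N}}|$, let $\sigma : X_{\mathcal{M}} \to X_{\mathcal{N}}$ be any bijection, and let $\Upsilon : \mathcal{M} \to \mathcal{N}$ be the associated universal bijection map. Then $\Upsilon$ is a $(1,2)$-magma isomorphism.
   Context: A $(1,2)$-magma is a triple $(\mathcal{M}, f, \star)$ with $\mathcal{M}$ a non-empty countable set, $f : \mathcal{M} \to \mathcal{M}$ a unary map and $\star : \mathcal{M} \times \mathcal{M} \to \mathcal{M}$ a binary map (written in-fix). A morphism from $(\mathcal{M}, f, \star)$ to $(\mathcal{N}, g, \ltimes)$ is a map $\theta : \mathcal{M} \to \mathcal{N}$ with $\theta(f(m)) = g(\theta(m))$ and $\theta(m \star m') = \theta(m) \ltimes \theta(m')$ for all $m, m' \in \mathcal{M}$; an isomorphism is a bijective morphism. $(\mathcal{M}, f, \star)$ is free if there exist a set $Y$ and a map $i : Y \to \mathcal{M}$ such that for every $(1,2)$-magma $(\mathcal{N}, g, \ltimes)$ and every map $\varphi : Y \to \mathcal{N}$ there exists a unique morphism $\theta : \mathcal{M} \to \mathcal{N}$ with $\varphi = \theta \circ i$; the image $i(Y)$ is called the generating set of $\mathcal{M}$. Definition of $\Upsilon$: on generators, $\Upsilon(\epsilon) = \sigma(\epsilon)$ for $\epsilon \in X_{\mathcal{M}}$. For $m \in \mathcal{M}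 \setminus X_{\mathcal{M}}$: (i) decompose $m$ into an expression in terms of generators $\epsilon_i \in X_{\mathcal{M}}$ and the maps $f$ and $\star$; (ii) in this expression replace every occurrence of each $\epsilon_i$ by $\sigma(\epsilon_i)$, every occurrence of $f$ by $g$ and every occurrence of $\star$ by $\ltimes$, obtaining an expression $\upsilon(m)$; (iii) let $\Upsilon(m)$ be the element of $\mathcal{N}$ obtained by evaluating all maps in $\upsilon(m)$. *)

theory Defs
  imports "HOL-Library.FuncSet" "HOL-Library.Countable_Set" "HOL-Library.Equipollence"
begin

definition magma12 :: "'a set \<Rightarrow> ('a \<Rightarrow> 'a) \<Rightarrow> ('a \<Rightarrow> 'a \<Rightarrow> 'a) \<Rightarrow> bool" where
  "magma12 M f s \<longleftrightarrow>
     M \<noteq> {} \<and> countable M \<and> f \<in> M \<rightarrow> M \<and> (\<forall>x\<in>M. \<forall>y\<in>M. s x y \<in> M)"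

definition magma12_hom ::
  "'a set \<Rightarrow> ('a \<Rightarrow> 'a) \<Rightarrow> ('a \<Rightarrow> 'a \<Rightarrow> 'a) \<Rightarrow>
   'b set \<Rightarrow> ('b \<Rightarrow> 'b) \<Rightarrow> ('b \<Rightarrow> 'b \<Rightarrow> 'b) \<Rightarrow> ('a \<Rightarrow> 'b) \<Rightarrow> bool" where
  "magma12_hom M f s N g t \<theta> \<longleftrightarrow>
     \<theta> \<in> M \<rightarrow> N \<and> (\<forall>m\<in>M. \<theta> (f m) = g (\<theta> m)) \<and>
     (\<forall>m\<in>M. \<forall>m'\<in>M. \<theta> (s m m') = t (\<theta> m) (\<theta> m'))"

definition magma12_iso ::
  "'a set \<Rightarrow> ('a \<Rightarrow> 'a) \<Rightarrow> ('a \<Rightarrow> 'a \<Rightarrow> 'a) \<Rightarrow>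
   'b set \<Rightarrow> ('b \<Rightarrow> 'b) \<Rightarrow> ('b \<Rightarrow> 'b \<Rightarrow> 'b) \<Rightarrow> ('a \<Rightarrow> 'b) \<Rightarrow> bool" where
  "magma12_iso M f s N g t \<theta> \<longleftrightarrow> magma12_hom M f s N g t \<theta> \<and> bij_betw \<theta> M N"

text \<open>
  A (1,2)-magma is free when the following holds for some \<open>Y\<close> and \<open>i\<close>; its generating
  set is then \<open>i ` Y\<close>. A definition cannot quantify over the type of the target magma. As
  magmas are countable, every one of them is isomorphic to one carried by a set of natural
  numbers, so it suffices to test against those; the lemma \<open>free_magma12_universal\<close> below
  recovers the universal property for targets of any type. Since functions are total,
  uniqueness is expressed for morphisms that are \<open>undefined\<close> outside the carrier.
\<close>

definition free_magma12 ::
  "'a set \<Rightarrow> ('a \<Rightarrow> 'a) \<Rightarrow> ('a \<Rightarrow> 'a \<Rightarrow> 'a) \<Rightarrow> 'y set \<Rightarrow> ('y \<Rightarrow> 'a) \<Rightarrow> bool" where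
  "free_magma12 M f s Y i \<longleftrightarrow>
     magma12 M f s \<and> i \<in> Y \<rightarrow> M \<and>
     (\<forall>(N :: nat set) g t \<phi>. magma12 N g t \<and> \<phi> \<in> Y \<rightarrow> N \<longrightarrow>
        (\<exists>!\<theta>. \<theta> \<in> extensional M \<and> magma12_hom M f s N g t \<theta> \<and> (\<forall>y\<in>Y. \<phi> y = \<theta> (i y))))"

lemma magma12_hom_restrict:
  assumes "magma12 M f s" "magma12_hom M f s N g t \<theta>"
  shows "magma12_hom M f s N g t (restrict \<theta> M)"
  using assms unfolding magma12_def magma12_hom_def by (auto simp: Pi_iff)

lemma magma12_hom_comp:
  assumes "magma12_hom M f s N g t \<theta>" "magma12_hom N g t P h u \<psi>"
  shows "magma12_hom M f s P h u (\<lambda>x. \<psi> (\<theta> x))"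
  using assms unfolding magma12_hom_def by (auto simp: Pi_iff)

lemma free_magma12_universal:
  fixes N :: "'b set"
  assumes free: "free_magma12 M f s Y i" and N: "magma12 N g t" and \<phi>: "\<phi> \<in> Y \<rightarrow> N"
  shows "\<exists>!\<theta>. \<theta> \<in> extensional M \<and> magma12_hom M f s N g t \<theta> \<and> (\<forall>y\<in>Y. \<phi> y = \<theta> (i y))"
proof -
  define c where "c = to_nat_on N"
  define d where "d = from_nat_into N"
  define P where "P = c ` N"
  define h where "h = (\<lambda>n. c (g (d n)))"
  define u where "u = (\<lambda>n n'. c (t (d n) (d n')))"
  have M: "magma12 M f s" and i: "i \<in> Y \<rightarrow> M"
    using free by (auto simp: free_magma12_def)
  have dc: "d (c x) = x" if "x \<in> N" for x
    using that N by (simp add: c_def d_def magma12_def)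
  have P: "magma12 P h u"
    using N unfolding magma12_def P_def h_def u_def by (auto simp: dc Pi_iff)
  have c: "magma12_hom N g t P h u c"
    using N unfolding magma12_hom_def magma12_def P_def h_def u_def by (auto simp: dc)
  have d: "magma12_hom P h u N g t d"
    using N unfolding magma12_hom_def magma12_def P_def h_def u_def by (auto simp: dc Pi_iff)
  have "(\<lambda>y. c (\<phi> y)) \<in> Y \<rightarrow> P"
    using \<phi> by (auto simp: P_def)
  then have ex1: "\<exists>!\<theta>. \<theta> \<in> extensional M \<and> magma12_hom M f s P h u \<theta> \<and> (\<forall>y\<in>Y. c (\<phi> y) = \<theta> (i y))"
    using free P unfolding free_magma12_def by blast
  then obtain \<theta> where \<theta>: "magma12_hom M f s P h u \<theta>" "\<forall>y\<in>Y. c (\<phi> y) = \<theta> (i y)"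
    by blast
  let ?\<theta> = "restrict (\<lambda>x. d (\<theta> x)) M"
  have "magma12_hom M f s N g t ?\<theta>"
    by (intro magma12_hom_restrict M magma12_hom_comp[OF \<theta>(1) d])
  moreover have "\<phi> y = ?\<theta> (i y)" if "y \<in> Y" for y
  proof -
    have "\<theta> (i y) = c (\<phi> y)" "\<phi> y \<in> N" "i y \<in> M"
      using \<theta>(2) that \<phi> i by auto
    then show ?thesis by (simp add: dc)
  qed
  ultimately show ?thesis
  proof (intro ex1I[of _ ?\<theta>] conjI ballI)
    fix \<psi> assume \<psi>: "\<psi> \<in> extensional M \<and> magma12_hom M f s N g t \<psi> \<and> (\<forall>y\<in>Y. \<phi> y = \<psi> (i y))"
    have *: "restrict (\<lambda>x. c (\<chi> x)) M = restrict \<theta> M"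
      if \<chi>: "magma12_hom M f s N g t \<chi>" "\<forall>y\<in>Y. \<phi> y = \<chi> (i y)" for \<chi>
    proof -
      have "magma12_hom M f s P h u (restrict (\<lambda>x. c (\<chi> x)) M)"
        by (intro magma12_hom_restrict M magma12_hom_comp[OF \<chi>(1) c])
      moreover have "magma12_hom M f s P h u (restrict \<theta> M)"
        by (intro magma12_hom_restrict M \<theta>)
      moreover have "\<forall>y\<in>Y. c (\<phi> y) = restrict (\<lambda>x. c (\<chi> x)) M (i y)"
        "\<forall>y\<in>Y. c (\<phi> y) = restrict \<theta> M (i y)"
        using \<chi>(2) \<theta>(2) i by (auto simp: Pi_iff)
      ultimately show ?thesis
        using ex1 by (metis (no_types, lifting) restrict_extensional)
    qed
    show "\<psi> = ?\<theta>"
    proof (rule extensionalityI)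
      show "\<psi> \<in> extensional M" using \<psi> by simp
      show "?\<theta> \<in> extensional M" by simp
      fix x assume x: "x \<in> M"
      then have "c (\<psi> x) = \<theta> x"
        using fun_cong[OF *[of \<psi>], of x] \<psi> by simp
      moreover have "\<psi> x \<in> N" using \<psi> x by (auto simp: magma12_hom_def)
      ultimately show "\<psi> x = ?\<theta> x" using x dc[of "\<psi> x"] by simp
    qed
  qed simp_all
qed

datatype 'x expr = Gen 'x | Unary "'x expr" | Binary "'x expr" "'x expr"

primrec eval_expr :: "('a \<Rightarrow> 'a) \<Rightarrow> ('a \<Rightarrow> 'a \<Rightarrow> 'a) \<Rightarrow> 'a expr \<Rightarrow> 'a" where
  "eval_expr f s (Gen x) = x"
| "eval_expr f s (Unary e) = f (eval_expr f s e)"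
| "eval_expr f s (Binary e e') = s (eval_expr f s e) (eval_expr f s e')"

definition decomposition_of ::
  "'a set \<Rightarrow> ('a \<Rightarrow> 'a) \<Rightarrow> ('a \<Rightarrow> 'a \<Rightarrow> 'a) \<Rightarrow> 'a \<Rightarrow> 'a expr \<Rightarrow> bool" where
  "decomposition_of X f s m e \<longleftrightarrow> set_expr e \<subseteq> X \<and> eval_expr f s e = m"

text \<open>
  The map \<open>\<Upsilon>\<close>. No property of decompositions (existence, uniqueness) is assumed: an
  arbitrary one is chosen. Replacing \<open>f\<close> by \<open>g\<close> and \<open>s\<close> by \<open>t\<close> amounts to
  evaluating the relabelled expression with \<open>g\<close> and \<open>t\<close>.
\<close>

definition universal_bijection ::
  "'a set \<Rightarrow> ('a \<Rightarrow> 'a) \<Rightarrow> ('a \<Rightarrow> 'a \<Rightarrow> 'a) \<Rightarrow> ('b \<Rightarrow> 'b) \<Rightarrow> ('b \<Rightarrow> 'b \<Rightarrow> 'b) \<Rightarrow>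
   ('a \<Rightarrow> 'b) \<Rightarrow> 'a \<Rightarrow> 'b" where
  "universal_bijection X f s g t \<sigma> m =
     (if m \<in> X then \<sigma> m
      else eval_expr g t (map_expr \<sigma> (SOME e. decomposition_of X f s m e)))"

end

theory Submission
  imports Defs
begin

text \<open>
  Freeness of \<open>M\<close> provides a morphism \<open>\<theta>\<close> into \<open>N\<close> that extends \<open>\<sigma>\<close>, and freeness of \<open>N\<close> one in
  the other direction that extends the inverse of \<open>\<sigma>\<close>. Both composites fix the generators, so both
  are the identity and \<open>\<theta>\<close> is an isomorphism.

  It remains to see that \<open>\<Upsilon>\<close> is \<open>\<theta>\<close> on \<open>M\<close>. Morphisms commute with the evaluation of expressions,
  so \<^emph>\<open>every\<close> decomposition of \<open>m\<close>, once relabelled along \<open>\<sigma>\<close>, evaluates to \<open>\<theta> m\<close>, in particular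
  the one picked by the definition of \<open>\<Upsilon>\<close>. That \<open>m\<close> has a decomposition at all is due to the
  induction principle \<open>free_magma12_induct\<close>: the universal property forces the generating set to
  generate. The same principle yields the uniqueness of morphisms used for the two composites.
\<close>

text \<open>
  A morphism out of \<open>M\<close> is determined by its values on the generators, so no proper submagma of \<open>M\<close>
  can contain them: two copies of \<open>M\<close> glued along such a submagma would receive two different
  morphisms that agree on the generators.
\<close>

lemma free_magma12_induct [consumes 2, case_names generator unary binary]:
  assumes free: "free_magma12 M f s Y i" and "m \<in> M"
    and generator: "\<And>y. y \<in> Y \<Longrightarrow> P (i y)"
    and unary: "\<And>x. x \<in> M \<Longrightarrow> P x \<Longrightarrow> P (f x)"
    and binary: "\<And>x y. x \<in> M \<Longrightarrow> y \<in> M \<Longrightarrow> P x \<Longrightarrow> P y \<Longrightarrow> P (s x y)"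
  shows "P m"
proof -
  \<comment> \<open>The flag tells the two copies of \<open>M\<close> apart. The operations clear it on every value that
    satisfies \<open>P\<close>, where the copies are to coincide; keeping it otherwise makes both \<open>\<alpha>\<close>
    and \<open>\<beta>\<close> morphisms.\<close>
  define h where "h = (\<lambda>(x, b). (f x, b \<and> \<not> P (f x)))"
  define u where "u = (\<lambda>(x, b) (y, c). (s x y, (b \<or> c) \<and> \<not> P (s x y)))"
  define \<alpha> where "\<alpha> = restrict (\<lambda>x. (x, False)) M"
  define \<beta> where "\<beta> = restrict (\<lambda>x. (x, \<not> P x)) M"
  have M: "magma12 M f s" and i: "i \<in> Y \<rightarrow> M"
    using free by (auto simp: free_magma12_def)
  have target: "magma12 (M \<times> (UNIV :: bool set)) h u"
    using M by (auto simp: magma12_def h_def u_def Pi_iff)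
  have \<alpha>: "magma12_hom M f s (M \<times> UNIV) h u \<alpha>"
    using M by (auto simp: magma12_hom_def magma12_def \<alpha>_def h_def u_def Pi_iff)
  have \<beta>: "magma12_hom M f s (M \<times> UNIV) h u \<beta>"
    using M unary binary
    by (auto simp: magma12_hom_def magma12_def \<beta>_def h_def u_def Pi_iff)
  have agree: "\<forall>y\<in>Y. \<alpha> (i y) = \<beta> (i y)"
    using i generator by (auto simp: \<alpha>_def \<beta>_def)
  have "(\<lambda>y. \<alpha> (i y)) \<in> Y \<rightarrow> M \<times> UNIV"
    using i by (auto simp: \<alpha>_def)
  from free_magma12_universal[OF free target this] have "\<alpha> = \<beta>"
    using \<alpha> \<beta> agree by (auto simp: \<alpha>_def \<beta>_def)
  then show "P m"
    using \<open>m \<in> M\<close> by (auto simp: \<alpha>_def \<beta>_def dest: fun_cong[where x = m])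
qed

lemma free_magma12_hom_eqI:
  assumes free: "free_magma12 M f s Y i"
    and \<theta>: "magma12_hom M f s N g t \<theta>" and \<psi>: "magma12_hom M f s N g t \<psi>"
    and agree: "\<And>y. y \<in> Y \<Longrightarrow> \<theta> (i y) = \<psi> (i y)"
    and "m \<in> M"
  shows "\<theta> m = \<psi> m"
  using free \<open>m \<in> M\<close>
  by (induction rule: free_magma12_induct) (use \<theta> \<psi> agree in \<open>auto simp: magma12_hom_def\<close>)

lemma free_magma12_decomposition_exists:
  assumes "free_magma12 M f s Y i" and "m \<in> M"
  shows "\<exists>e. decomposition_of (i ` Y) f s m e"
  using assms
proof (induction rule: free_magma12_induct)
  case (generator y)
  then have "decomposition_of (i ` Y) f s (i y) (Gen (i y))"
    by (simp add: decomposition_of_def)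
  then show ?case ..
next
  case (unary x)
  then obtain e where "decomposition_of (i ` Y) f s x e" by blast
  then have "decomposition_of (i ` Y) f s (f x) (Unary e)"
    by (simp add: decomposition_of_def)
  then show ?case ..
next
  case (binary x y)
  then obtain e e' where "decomposition_of (i ` Y) f s x e" "decomposition_of (i ` Y) f s y e'"
    by blast
  then have "decomposition_of (i ` Y) f s (s x y) (Binary e e')"
    by (simp add: decomposition_of_def)
  then show ?case ..
qed

lemma magma12_eval_expr_closed:
  assumes "magma12 M f s" and "set_expr e \<subseteq> M"
  shows "eval_expr f s e \<in> M"
  using assms by (induction e) (auto simp: magma12_def Pi_iff)

lemma magma12_hom_eval_expr:
  assumes M: "magma12 M f s" and \<theta>: "magma12_hom M f s N g t \<theta>" and "set_expr e \<subseteq> M"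
  shows "\<theta> (eval_expr f s e) = eval_expr g t (map_expr \<theta> e)"
  using \<open>set_expr e \<subseteq> M\<close>
  by (induction e) (use \<theta> magma12_eval_expr_closed[OF M] in \<open>auto simp: magma12_hom_def\<close>)

text \<open>
  The value of \<open>\<Upsilon>\<close> does not depend on the chosen decomposition: whichever is taken, a morphism
  extending \<open>\<sigma>\<close> carries the value of the original expression to that of the relabelled one.
\<close>

lemma universal_bijection_eq_hom:
  assumes free: "free_magma12 M f s Y i"
    and \<theta>: "magma12_hom M f s N g t \<theta>"
    and extends: "\<And>x. x \<in> i ` Y \<Longrightarrow> \<theta> x = \<sigma> x"
    and "m \<in> M"
  shows "universal_bijection (i ` Y) f s g t \<sigma> m = \<theta> m"
proof (cases "m \<in> i ` Y")
  case True
  then show ?thesis by (simp add: universal_bijection_def extends)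
next
  case False
  define e where "e = (SOME e. decomposition_of (i ` Y) f s m e)"
  have M: "magma12 M f s" and i: "i ` Y \<subseteq> M"
    using free by (auto simp: free_magma12_def)
  have "decomposition_of (i ` Y) f s m e"
    unfolding e_def by (rule someI_ex) (rule free_magma12_decomposition_exists[OF free \<open>m \<in> M\<close>])
  then have e: "set_expr e \<subseteq> i ` Y" "eval_expr f s e = m"
    by (auto simp: decomposition_of_def)
  have "map_expr \<sigma> e = map_expr \<theta> e"
    using e(1) extends by (intro expr.map_cong) auto
  then have "eval_expr g t (map_expr \<sigma> e) = \<theta> m"
    using magma12_hom_eval_expr[OF M \<theta>] e i by (metis subset_trans)
  then show ?thesis
    using False by (simp add: universal_bijection_def e_def)
qed

lemma free_magma12_hom_extension:
  assumes free: "free_magma12 M f s Y i" and N: "magma12 N g t" and \<sigma>: "\<sigma> \<in> i ` Y \<rightarrow> N"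
  obtains \<theta> where "magma12_hom M f s N g t \<theta>" "\<And>x. x \<in> i ` Y \<Longrightarrow> \<theta> x = \<sigma> x"
proof -
  have "(\<lambda>y. \<sigma> (i y)) \<in> Y \<rightarrow> N"
    using \<sigma> by auto
  then obtain \<theta> where "magma12_hom M f s N g t \<theta>" "\<forall>y\<in>Y. \<sigma> (i y) = \<theta> (i y)"
    using free_magma12_universal[OF free N] by blast
  then show thesis
    by (intro that[of \<theta>]) auto
qed

lemma free_magma12_endomorphism_eq_id:
  assumes "free_magma12 M f s Y i" and "magma12_hom M f s M f s \<theta>"
    and "\<And>y. y \<in> Y \<Longrightarrow> \<theta> (i y) = i y" and "m \<in> M"
  shows "\<theta> m = m"
  using free_magma12_hom_eqI[OF assms(1,2), of "\<lambda>x. x"] assms(3,4)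
  by (auto simp: magma12_hom_def)

theorem proposition13:
  fixes M :: "'a set" and f :: "'a \<Rightarrow> 'a" and s :: "'a \<Rightarrow> 'a \<Rightarrow> 'a"
    and N :: "'b set" and g :: "'b \<Rightarrow> 'b" and t :: "'b \<Rightarrow> 'b \<Rightarrow> 'b"
    and Y\<^sub>M :: "'c set" and i\<^sub>M :: "'c \<Rightarrow> 'a" and Y\<^sub>N :: "'d set" and i\<^sub>N :: "'d \<Rightarrow> 'b"
    and X\<^sub>M :: "'a set" and X\<^sub>N :: "'b set" and \<sigma> :: "'a \<Rightarrow> 'b"
  assumes "free_magma12 M f s Y\<^sub>M i\<^sub>M" and "X\<^sub>M = i\<^sub>M ` Y\<^sub>M"
    and "free_magma12 N g t Y\<^sub>N i\<^sub>N" and "X\<^sub>N = i\<^sub>N ` Y\<^sub>N"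
    and "X\<^sub>M \<approx> X\<^sub>N"
    and "bij_betw \<sigma> X\<^sub>M X\<^sub>N"
  shows "magma12_iso M f s N g t (universal_bijection X\<^sub>M f s g t \<sigma>)"
proof -
  define X where "X = i\<^sub>M ` Y\<^sub>M"
  define Z where "Z = i\<^sub>N ` Y\<^sub>N"
  let ?\<tau> = "inv_into X \<sigma>"
  let ?\<Upsilon> = "universal_bijection X f s g t \<sigma>"
  note freeM = assms(1) and freeN = assms(3)
  have M: "magma12 M f s" and X: "X \<subseteq> M" and N: "magma12 N g t" and Z: "Z \<subseteq> N"
    using freeM freeN by (auto simp: free_magma12_def X_def Z_def)
  have \<sigma>: "bij_betw \<sigma> X Z"
    using assms by (simp add: X_def Z_def)
  then have \<tau>: "bij_betw ?\<tau> Z X"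
    by (rule bij_betw_inv_into)
  obtain \<theta> where \<theta>: "magma12_hom M f s N g t \<theta>" "\<And>x. x \<in> X \<Longrightarrow> \<theta> x = \<sigma> x"
    using free_magma12_hom_extension[OF freeM N, of \<sigma>] bij_betwE[OF \<sigma>] Z
    unfolding X_def[symmetric] by blast
  obtain \<psi> where \<psi>: "magma12_hom N g t M f s \<psi>" "\<And>z. z \<in> Z \<Longrightarrow> \<psi> z = ?\<tau> z"
    using free_magma12_hom_extension[OF freeN M, of ?\<tau>] bij_betwE[OF \<tau>] X
    unfolding Z_def[symmetric] by blast
  have "\<psi> (\<theta> (i\<^sub>M y)) = i\<^sub>M y" if "y \<in> Y\<^sub>M" for y
  proof -
    have "i\<^sub>M y \<in> X" using that by (simp add: X_def)
    then show ?thesis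
      using \<theta>(2) \<psi>(2) bij_betwE[OF \<sigma>] bij_betw_inv_into_left[OF \<sigma>] by simp
  qed
  then have \<psi>\<theta>: "\<psi> (\<theta> m) = m" if "m \<in> M" for m
    using free_magma12_endomorphism_eq_id[OF freeM magma12_hom_comp[OF \<theta>(1) \<psi>(1)]] that by blast
  have "\<theta> (\<psi> (i\<^sub>N y)) = i\<^sub>N y" if "y \<in> Y\<^sub>N" for y
  proof -
    have "i\<^sub>N y \<in> Z" using that by (simp add: Z_def)
    then show ?thesis
      using \<theta>(2) \<psi>(2) bij_betwE[OF \<tau>] bij_betw_inv_into_right[OF \<sigma>] by simp
  qed
  then have \<theta>\<psi>: "\<theta> (\<psi> n) = n" if "n \<in> N" for n
    using free_magma12_endomorphism_eq_id[OF freeN magma12_hom_comp[OF \<psi>(1) \<theta>(1)]] that by blast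
  have \<Upsilon>: "?\<Upsilon> m = \<theta> m" if "m \<in> M" for m
    unfolding X_def
    by (rule universal_bijection_eq_hom[OF freeM \<theta>(1) _ that]) (simp add: \<theta>(2) X_def)
  have "bij_betw \<theta> M N"
    by (rule bij_betw_byWitness[of M \<psi>])
      (use \<psi>\<theta> \<theta>\<psi> \<theta>(1) \<psi>(1) in \<open>auto simp: magma12_hom_def\<close>)
  then have "bij_betw ?\<Upsilon> M N"
    using \<Upsilon> by (simp cong: bij_betw_cong)
  moreover have "magma12_hom M f s N g t ?\<Upsilon>"
    using \<theta>(1) M \<Upsilon> by (auto simp: magma12_hom_def magma12_def Pi_iff)
  ultimately show ?thesis
    using assms(2) by (simp add: magma12_iso_def X_def)
qed

end
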